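(* Let $\gamma(s)$ be a partially null curve in $E_1^4$ with Frenet vector fields $F_1,\dots,F_4$ and first curvature $k_1=k_1(s)$, and let the radius $r$ be constant. Consider the tubular hypersurfaces $T_1,T_2,T_3$ (envelopes of families of pseudo hyperspheres with centers on $\gamma$) and $T_4$ (envelope of a family of pseudo hyperbolic hyperspheres with centers on $\gamma$), parametrized by $(s,t,w)$ as $$T_1=\gamma\mp r\left(\sin f\,F_2+g\cos f\,F_3+\tfrac{\cos f}{2g}F_4\right),\quad T_2=\gamma\mp r\left(\cos f\,F_2+g\sin f\,F_3+\tfrac{\sin f}{2g}F_4\right),$$ $$T_3=\gamma\mp r\left(\cosh f\,F_2+g\sinh f\,F_3-\tfrac{\sinh f}{2g}F_4\right),\quad T_4=\gamma\mp r\left(\sinh f\,F_2+g\cosh f\,F_3-\tfrac{\cosh f}{2g}F_4\right).$$ The Gaussian curvatures $K_{T_i}$ and mean curvatures $H_{T_i}$ of $T_i$, $i\in\{1,2,3,4\}$, are $$K_{T_1}=\frac{k_1}{r^2(\csc f-rk_1)},\qquad H_{T_1}=\frac{1}{-r+\frac{r}{-2+3rk_1\sin f}};$$ $$K_{T_2}=\frac{-k_1}{r^2(\sec f-rk_1)},\qquad H_{T_2}=\frac{-1}{-r+\frac{r}{-2+3rk_1\cos f}};$$ $$K_{T_3}=\frac{k_1}{r^2(\mathrm{sech} f-rk_1)},\qquad H_{T_3}=\frac{1}{-r+\frac{r}{-2+3rk_1\cosh f}};$$ $$K_{T_4}=\frac{-k_1}{r^2(\mathrm{csch} f-rk_1)},\qquad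 H_{T_4}=\frac{-1}{-r+\frac{r}{-2+3rk_1\sinh f}}.$$
   Context: $E_1^4$ is $\mathbb{R}^4$ with $\langle u,v\rangle=-u_1v_1+u_2v_2+u_3v_3+u_4v_4$ and norm $\|u\|=\sqrt{|\langle u,u\rangle|}$. The vector product $u\times v\times w$ is the formal determinant with rows $(-e_1,e_2,e_3,e_4)$, $u$, $v$, $w$. A pseudo hypersphere (respectively pseudo hyperbolic hypersphere) with center $p$ and radius $r>0$ is the set of $u$ with $\langle u-p,u-p\rangle=r^2$ (respectively $-r^2$). A partially null curve is a spacelike curve $\gamma(s)$ whose binormal vector is null; its Frenet frame consists of the unit tangent $F_1$, principal normal $F_2$, binormal $F_3$ and trinormal $F_4$, with $\langle F_1,F_1\rangle=\langle F_2,F_2\rangle=\langle F_3,F_4\rangle=1$, all other products $\langle F_i,F_j\rangle$ zero, and $F_1'=k_1F_2$, $F_2'=-k_1F_1+k_2F_3$, $F_3'=k_3F_3$, $F_4'=-k_2F_2-k_3F_4$, where $k_3(s)=0$ for each $s$. Here $f=f(t,w)$ and $g=g(t,w)$. For a hypersurface $\Omega(u_1,u_2,u_3)$ in $E_1^4$ the unit normal vector field is $N=\dfrac{\Omega_{u_1}\times\Omega_{u_2}\times\Omega_{u_3}}{\|\Omega_{u_1}\times\Omega_{u_2}\times\Omega_{u_3}\|}$, and $\varepsilon=\langle N,N\rangle$. Put $g_{ij}=\langle\Omega_{u_i},\Omega_{u_j}\rangle$, $h_{ij}=\langle\Omega_{u_iu_j},N\rangle$, $S=[g_{ij}]^{-1}[h_{ij}]$.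 The Gaussian curvature $K$ and mean curvature $H$ are given by $K=\varepsilon\det[h_{ij}]/\det[g_{ij}]$ and $3\varepsilon H=\operatorname{tr}S$.
   Formalization: The printed formulas are proved for the lower sign of ∓ when N is the radial field (minus it for T_2); for the upper sign r becomes -r in them, and for the opposite N both K and H change sign. They are claimed only where N and the formulas are defined. *)

theory Defs
  imports "HOL-Analysis.Analysis"
begin

definition mink :: "real^4 \<Rightarrow> real^4 \<Rightarrow> real" where
  "mink u v = - (u$1 * v$1) + u$2 * v$2 + u$3 * v$3 + u$4 * v$4"

definition mnorm :: "real^4 \<Rightarrow> real" where
  "mnorm u = sqrt \<bar>mink u u\<bar>"

text \<open>The formal determinant with rows (-e1, e2, e3, e4), u, v, w: its component along the i-th
  basis vector is the cofactor obtained by replacing the formal row by that basis vector,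
  with the sign the row carries there.\<close>

definition vprod :: "real^4 \<Rightarrow> real^4 \<Rightarrow> real^4 \<Rightarrow> real^4" where
  "vprod u v w =
     (\<chi> i. (if i = 1 then - 1 else 1) * det (vector [axis i 1, u, v, w] :: real^4^4))"

text \<open>The curve is parametrized by arc length on an open interval I, with curvatures k1, k2, k3.
  Differentiability of k1 and k2 is the part of smoothness of the curve that the
  Frenet equations alone do not give.\<close>

definition partially_null_curve ::
  "real set \<Rightarrow> (real \<Rightarrow> real^4) \<Rightarrow> (real \<Rightarrow> real^4) \<Rightarrow> (real \<Rightarrow> real^4) \<Rightarrow> (real \<Rightarrow> real^4) \<Rightarrow>
   (real \<Rightarrow> real^4) \<Rightarrow> (real \<Rightarrow> real) \<Rightarrow> (real \<Rightarrow> real) \<Rightarrow> (real \<Rightarrow> real) \<Rightarrow> bool" where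
  "partially_null_curve I \<gamma> F1 F2 F3 F4 k1 k2 k3 \<longleftrightarrow>
     open I \<and> is_interval I \<and> k1 differentiable_on I \<and> k2 differentiable_on I \<and>
     (\<forall>s\<in>I.
        mink (F1 s) (F1 s) = 1 \<and> mink (F2 s) (F2 s) = 1 \<and> mink (F3 s) (F4 s) = 1 \<and>
        mink (F1 s) (F2 s) = 0 \<and> mink (F1 s) (F3 s) = 0 \<and> mink (F1 s) (F4 s) = 0 \<and>
        mink (F2 s) (F3 s) = 0 \<and> mink (F2 s) (F4 s) = 0 \<and>
        mink (F3 s) (F3 s) = 0 \<and> mink (F4 s) (F4 s) = 0 \<and>
        (\<gamma> has_vector_derivative F1 s) (at s) \<and>
        (F1 has_vector_derivative k1 s *\<^sub>R F2 s) (at s) \<and>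
        (F2 has_vector_derivative - k1 s *\<^sub>R F1 s + k2 s *\<^sub>R F3 s) (at s) \<and>
        (F3 has_vector_derivative k3 s *\<^sub>R F3 s) (at s) \<and>
        (F4 has_vector_derivative - k2 s *\<^sub>R F2 s - k3 s *\<^sub>R F4 s) (at s) \<and>
        k3 s = 0)"

text \<open>Hypersurfaces are given by a parametrization; the parameters are the components of its
  argument.\<close>

definition pderiv_at :: "3 \<Rightarrow> (real^3 \<Rightarrow> 'b::real_normed_vector) \<Rightarrow> real^3 \<Rightarrow> 'b" where
  "pderiv_at i \<Omega> u = vector_derivative (\<lambda>h. \<Omega> (u + h *\<^sub>R axis i 1)) (at 0)"

definition normal_vec :: "(real^3 \<Rightarrow> real^4) \<Rightarrow> real^3 \<Rightarrow> real^4" where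
  "normal_vec \<Omega> u = vprod (pderiv_at 1 \<Omega> u) (pderiv_at 2 \<Omega> u) (pderiv_at 3 \<Omega> u)"

text \<open>The sign of this field depends on the orientation of the parameters (and, for the tubes
  below, of the Frenet frame). In dimension three both curvatures change sign with it.\<close>

definition unit_normal :: "(real^3 \<Rightarrow> real^4) \<Rightarrow> real^3 \<Rightarrow> real^4" where
  "unit_normal \<Omega> u = normal_vec \<Omega> u /\<^sub>R mnorm (normal_vec \<Omega> u)"

text \<open>The points where the unit normal is defined.\<close>

definition regular_point :: "(real^3 \<Rightarrow> real^4) \<Rightarrow> real^3 \<Rightarrow> bool" where
  "regular_point \<Omega> u \<longleftrightarrow> mnorm (normal_vec \<Omega> u) \<noteq> 0"

definition normal_sign :: "(real^3 \<Rightarrow> real^4) \<Rightarrow> real^3 \<Rightarrow> real" where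
  "normal_sign \<Omega> u = mink (unit_normal \<Omega> u) (unit_normal \<Omega> u)"

definition first_form :: "(real^3 \<Rightarrow> real^4) \<Rightarrow> real^3 \<Rightarrow> real^3^3" where
  "first_form \<Omega> u = (\<chi> i j. mink (pderiv_at i \<Omega> u) (pderiv_at j \<Omega> u))"

definition second_form :: "(real^3 \<Rightarrow> real^4) \<Rightarrow> real^3 \<Rightarrow> real^3^3" where
  "second_form \<Omega> u = (\<chi> i j. mink (pderiv_at j (pderiv_at i \<Omega>) u) (unit_normal \<Omega> u))"

definition shape_operator :: "(real^3 \<Rightarrow> real^4) \<Rightarrow> real^3 \<Rightarrow> real^3^3" where
  "shape_operator \<Omega> u = matrix_inv (first_form \<Omega> u) ** second_form \<Omega> u"

definition gaussian_curvature :: "(real^3 \<Rightarrow> real^4) \<Rightarrow> real^3 \<Rightarrow> real" where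
  "gaussian_curvature \<Omega> u = normal_sign \<Omega> u * det (second_form \<Omega> u) / det (first_form \<Omega> u)"

definition mean_curvature :: "(real^3 \<Rightarrow> real^4) \<Rightarrow> real^3 \<Rightarrow> real" where
  "mean_curvature \<Omega> u = trace (shape_operator \<Omega> u) / (3 * normal_sign \<Omega> u)"

definition C2_on :: "(real \<times> real) set \<Rightarrow> (real \<times> real \<Rightarrow> real) \<Rightarrow> bool" where
  "C2_on D \<phi> \<longleftrightarrow>
     (\<exists>(\<phi>' :: real \<times> real \<Rightarrow> (real \<times> real) \<Rightarrow>\<^sub>L real)
       (\<phi>'' :: real \<times> real \<Rightarrow> (real \<times> real) \<Rightarrow>\<^sub>L (real \<times> real) \<Rightarrow>\<^sub>L real).
        (\<forall>p\<in>D. (\<phi> has_derivative blinfun_apply (\<phi>' p)) (at p)) \<and>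
        (\<forall>p\<in>D. (\<phi>' has_derivative blinfun_apply (\<phi>'' p)) (at p)) \<and>
        continuous_on D \<phi>'')"

text \<open>The radial fields of the four families, in the parameters u = (s, t, w).
  The first three are unit spacelike, the last one is unit timelike.\<close>

definition radial1 where
  "radial1 F2 F3 F4 f g u = (let s = u$1; \<phi> = f (u$2, u$3); a = g (u$2, u$3) in
     sin \<phi> *\<^sub>R F2 s + (a * cos \<phi>) *\<^sub>R F3 s + (cos \<phi> / (2 * a)) *\<^sub>R F4 s)"
  for F2 F3 F4 :: "real \<Rightarrow> real^4" and f g :: "real \<times> real \<Rightarrow> real" and u :: "real^3"

definition radial2 where
  "radial2 F2 F3 F4 f g u = (let s = u$1; \<phi> = f (u$2, u$3); a = g (u$2, u$3) in
     cos \<phi> *\<^sub>R F2 s + (a * sin \<phi>) *\<^sub>R F3 s + (sin \<phi> / (2 * a)) *\<^sub>R F4 s)"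
  for F2 F3 F4 :: "real \<Rightarrow> real^4" and f g :: "real \<times> real \<Rightarrow> real" and u :: "real^3"

definition radial3 where
  "radial3 F2 F3 F4 f g u = (let s = u$1; \<phi> = f (u$2, u$3); a = g (u$2, u$3) in
     cosh \<phi> *\<^sub>R F2 s + (a * sinh \<phi>) *\<^sub>R F3 s - (sinh \<phi> / (2 * a)) *\<^sub>R F4 s)"
  for F2 F3 F4 :: "real \<Rightarrow> real^4" and f g :: "real \<times> real \<Rightarrow> real" and u :: "real^3"

definition radial4 where
  "radial4 F2 F3 F4 f g u = (let s = u$1; \<phi> = f (u$2, u$3); a = g (u$2, u$3) in
     sinh \<phi> *\<^sub>R F2 s + (a * cosh \<phi>) *\<^sub>R F3 s - (cosh \<phi> / (2 * a)) *\<^sub>R F4 s)"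
  for F2 F3 F4 :: "real \<Rightarrow> real^4" and f g :: "real \<times> real \<Rightarrow> real" and u :: "real^3"

text \<open>The sign sg encodes the double sign in front of r: -1 is the upper sign, 1 the lower one.
  The two branches do not have the same curvatures: they are exchanged by replacing r with -r,
  so the curvature formulas involve the product sg * r.\<close>

definition tube :: "real \<Rightarrow> real \<Rightarrow> (real \<Rightarrow> real^4) \<Rightarrow> (real^3 \<Rightarrow> real^4) \<Rightarrow> real^3 \<Rightarrow> real^4" where
  "tube sg r \<gamma> n u = \<gamma> (u$1) + (sg * r) *\<^sub>R n u"

definition csc :: "real \<Rightarrow> real" where "csc x = 1 / sin x"
definition sec :: "real \<Rightarrow> real" where "sec x = 1 / cos x"
definition sech :: "real \<Rightarrow> real" where "sech x = 1 / cosh x"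
definition csch :: "real \<Rightarrow> real" where "csch x = 1 / sinh x"

end

theory Submission
  imports Defs
begin

text \<open>
  All four hypersurfaces have the form \<open>T = \<gamma> + \<rho> n\<close>, where \<open>\<rho>\<close> is the signed radius and
  \<open>n = A F2 + B F3 + C F4\<close> has constant square \<open>A\<^sup>2 + 2 B C = e\<close> equal to \<open>1\<close> or \<open>-1\<close>. Here \<open>A, B, C\<close>
  depend on \<open>(t, w)\<close> only, and one computation with arbitrary such coefficients covers all four.

  The field \<open>n\<close> is orthogonal to all partial derivatives of \<open>T\<close>: for \<open>t\<close> and \<open>w\<close> because its square
  is constant, for \<open>s\<close> because in addition \<open>n\<close> is orthogonal to \<open>F1\<close>. So the unit normal is \<open>c n\<close>
  with \<open>c\<close> equal to \<open>1\<close> or \<open>-1\<close> (\<open>vprod_parallel\<close>). Differentiating \<open>T = \<gamma> + \<rho> n\<close> expresses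
  the derivative of \<open>n\<close> by that of \<open>T\<close>, and the Weingarten equation (\<open>mink_pderiv_orthogonal\<close>) gives
  \<open>h = - (c / \<rho>) (G - a E)\<close>, where \<open>G\<close> is the first fundamental form, \<open>E\<close> the matrix unit at the
  entry \<open>(1,1)\<close>, and \<open>a = 1 - \<rho> k1 A\<close> the product of \<open>T\<^sub>s\<close> with \<open>F1\<close>.

  Geometrically, \<open>T\<^sub>s - a F1\<close> lies in the plane orthogonal to \<open>F1\<close> and \<open>n\<close>, as do \<open>T\<^sub>t\<close> and \<open>T\<^sub>w\<close>.
  Hence \<open>det G\<close> is \<open>a\<^sup>2\<close> times its cofactor at \<open>(1,1)\<close> (\<open>det_first_form\<close>), and \<open>k2\<close> and the
  derivatives of the coefficients drop out:
  \<open>K = c e k1 A / (r\<^sup>2 a)\<close> and \<open>H = c e (3 \<rho> k1 A - 2) / (3 \<rho> a)\<close> (\<open>curvatures\<close>). The stated formulas are these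
  with \<open>A\<close> equal to \<open>sin f\<close>, \<open>cos f\<close>, \<open>cosh f\<close>, \<open>sinh f\<close>, where \<open>e = -1\<close> in the last case
  and the second case counts signs from \<open>- n\<close>.
\<close>

section \<open>Linear algebra in Minkowski space\<close>

lemma det_4:
  "det (A::'a::comm_ring_1^4^4) =
     A$1$1 * (A$2$2 * (A$3$3 * A$4$4 - A$3$4 * A$4$3) - A$2$3 * (A$3$2 * A$4$4 - A$3$4 * A$4$2)
              + A$2$4 * (A$3$2 * A$4$3 - A$3$3 * A$4$2))
   - A$1$2 * (A$2$1 * (A$3$3 * A$4$4 - A$3$4 * A$4$3) - A$2$3 * (A$3$1 * A$4$4 - A$3$4 * A$4$1)
              + A$2$4 * (A$3$1 * A$4$3 - A$3$3 * A$4$1))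
   + A$1$3 * (A$2$1 * (A$3$2 * A$4$4 - A$3$4 * A$4$2) - A$2$2 * (A$3$1 * A$4$4 - A$3$4 * A$4$1)
              + A$2$4 * (A$3$1 * A$4$2 - A$3$2 * A$4$1))
   - A$1$4 * (A$2$1 * (A$3$2 * A$4$3 - A$3$3 * A$4$2) - A$2$2 * (A$3$1 * A$4$3 - A$3$3 * A$4$1)
              + A$2$3 * (A$3$1 * A$4$2 - A$3$2 * A$4$1))"
proof -
  have f1234: "finite {2::4, 3, 4}" "1 \<notin> {2::4, 3, 4}"
    by auto
  have f234: "finite {3::4, 4}" "2 \<notin> {3::4, 4}"
    by auto
  have f34: "finite {4::4}" "3 \<notin> {4::4}"
    by auto
  show ?thesis
    unfolding det_def UNIV_4
    unfolding sum_over_permutations_insert[OF f1234]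
    unfolding sum_over_permutations_insert[OF f234]
    unfolding sum_over_permutations_insert[OF f34]
    unfolding permutes_sing
    by (simp add: sign_swap_id permutation_swap_id sign_compose sign_id permutation_compose
        swap_id_eq algebra_simps)
qed

lemma vector_4:
  "(vector [x, y, z, w] :: 'a::zero^4)$1 = x"
  "(vector [x, y, z, w] :: 'a::zero^4)$2 = y"
  "(vector [x, y, z, w] :: 'a::zero^4)$3 = z"
  "(vector [x, y, z, w] :: 'a::zero^4)$4 = w"
  by (simp_all add: vector_def)

lemma vprod_nth:
  "vprod u v w $ 1 = - (u$2 * (v$3 * w$4 - v$4 * w$3) - u$3 * (v$2 * w$4 - v$4 * w$2)
                        + u$4 * (v$2 * w$3 - v$3 * w$2))"
  "vprod u v w $ 2 = - (u$1 * (v$3 * w$4 - v$4 * w$3) - u$3 * (v$1 * w$4 - v$4 * w$1)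
                        + u$4 * (v$1 * w$3 - v$3 * w$1))"
  "vprod u v w $ 3 = u$1 * (v$2 * w$4 - v$4 * w$2) - u$2 * (v$1 * w$4 - v$4 * w$1)
                        + u$4 * (v$1 * w$2 - v$2 * w$1)"
  "vprod u v w $ 4 = - (u$1 * (v$2 * w$3 - v$3 * w$2) - u$2 * (v$1 * w$3 - v$3 * w$1)
                        + u$3 * (v$1 * w$2 - v$2 * w$1))"
  by (simp_all add: vprod_def det_4 vector_4 axis_def)

text \<open>The Minkowski form of Lagrange's identity; the sign is the determinant of the metric. It makes
  the first fundamental form invertible exactly where the unit normal exists.\<close>

lemma gram_det_eq_vprod:
  fixes x :: "3 \<Rightarrow> real^4"
  shows "det (\<chi> i j. mink (x i) (x j)) = - mink (vprod (x 1) (x 2) (x 3)) (vprod (x 1) (x 2) (x 3))"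
  by (simp add: det_3 mink_def vprod_nth) algebra

text \<open>Three vectors orthogonal to \<open>n\<close> have a vector product proportional to \<open>n\<close>: by Cramer's rule
  \<open>det (n,u,v,w)\<close> times any \<open>x\<close> is a combination of \<open>u, v, w\<close> plus
  \<open>det (x,u,v,w)\<close> times \<open>n\<close>; take its product with \<open>n\<close>. The form without division
  also covers null \<open>n\<close>.\<close>

lemma vprod_parallel:
  assumes "mink n u = 0" "mink n v = 0" "mink n w = 0"
  shows "mink n n *\<^sub>R vprod u v w = mink n (vprod u v w) *\<^sub>R n"
proof -
  note * = assms[unfolded mink_def]
  show ?thesis
    unfolding vec_eq_iff forall_4 using *
    by (simp add: mink_def vprod_nth) (intro conjI; algebra)
qed

text \<open>Since \<open>h = \<mu> (G - a E)\<close> with \<open>E\<close> the matrix unit at the entry \<open>(1,1)\<close>, the trace of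
  \<open>G\<^sup>-\<^sup>1 h\<close> involves \<open>G\<^sup>-\<^sup>1\<close> only through its entry at \<open>(1,1)\<close>, a cofactor over the determinant.\<close>

lemma trace_matrix_inv_rank_one:
  fixes G h :: "real^3^3"
  assumes G: "det G \<noteq> 0"
    and h: "h = (\<chi> i j. \<mu> * (G$i$j - (if i = 1 \<and> j = 1 then a else 0)))"
  shows "trace (matrix_inv G ** h) = \<mu> * (3 - a * (G$2$2 * G$3$3 - G$2$3 * G$3$2) / det G)"
proof -
  define P where "P = matrix_inv G"
  have "invertible G" using G by (simp add: invertible_det_nz)
  then have GP: "G ** P = mat 1" and PG: "P ** G = mat 1"
    unfolding P_def matrix_inv_def invertible_def by (metis (mono_tags, lifting) someI_ex)+
  have "G *v (P *v axis 1 1) = axis 1 1"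
    by (simp add: matrix_vector_mul_assoc GP)
  then have "P *v axis 1 1 = (\<chi> k. det (\<chi> i j. if j = k then (axis 1 1 :: real^3)$i else G$i$j) / det G)"
    using cramer[OF G] by blast
  then have "(P *v axis 1 1)$1 = (G$2$2 * G$3$3 - G$2$3 * G$3$2) / det G"
    by (simp add: det_3 axis_def)
  then have P11: "P$1$1 = (G$2$2 * G$3$3 - G$2$3 * G$3$2) / det G"
    by (simp add: matrix_vector_mult_basis column_def)
  have PG_diag: "P$i$1 * G$1$i + P$i$2 * G$2$i + P$i$3 * G$3$i = 1" for i
  proof -
    have "(P ** G)$i$i = 1" by (simp add: PG mat_def)
    then show ?thesis by (simp add: matrix_matrix_mult_def sum_3)
  qed
  have "trace (P ** h) = \<mu> * ((P$1$1 * G$1$1 + P$1$2 * G$2$1 + P$1$3 * G$3$1)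
      + (P$2$1 * G$1$2 + P$2$2 * G$2$2 + P$2$3 * G$3$2)
      + (P$3$1 * G$1$3 + P$3$2 * G$2$3 + P$3$3 * G$3$3) - a * P$1$1)"
    unfolding trace_def matrix_matrix_mult_def h sum_3 vec_lambda_beta
    by (simp add: algebra_simps)
  then have "trace (P ** h) = \<mu> * (3 - a * P$1$1)"
    unfolding PG_diag by simp
  then show ?thesis unfolding P11 by (simp add: P_def)
qed

lemma bounded_bilinear_mink: "bounded_bilinear mink"
  unfolding bilinear_conv_bounded_bilinear[symmetric] bilinear_def
  by (auto simp: linear_iff mink_def algebra_simps)

interpretation mink: bounded_bilinear mink
  by (rule bounded_bilinear_mink)

lemma mink_commute: "mink u v = mink v u"
  by (simp add: mink_def mult.commute)

section \<open>Differentiating parametrizations\<close>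

lemma pderiv_at_eq:
  assumes "(\<Omega> has_derivative L) (at u)"
  shows "pderiv_at i \<Omega> u = L (axis i 1)"
proof -
  have "(\<Omega> has_derivative L) (at (u + 0 *\<^sub>R axis i 1))"
    using assms by simp
  then have "((\<lambda>h. \<Omega> (u + h *\<^sub>R axis i 1)) has_derivative (\<lambda>h. L (h *\<^sub>R axis i 1))) (at 0)"
    by (rule has_derivative_compose[rotated]) (auto intro!: derivative_eq_intros)
  then have "((\<lambda>h. \<Omega> (u + h *\<^sub>R axis i 1)) has_vector_derivative L (axis i 1)) (at 0)"
    using has_derivative_linear[OF assms]
    by (simp add: has_vector_derivative_def linear_cmul)
  then show ?thesis
    unfolding pderiv_at_def by (rule vector_derivative_at)
qed

text \<open>The Weingarten equation. With \<open>X\<close> a first partial derivative of a hypersurface and \<open>n\<close> normal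
  to it, this trades second derivatives of the hypersurface for first derivatives of the normal.\<close>

lemma mink_pderiv_orthogonal:
  assumes U: "open U" "u \<in> U" and orth: "\<And>v. v \<in> U \<Longrightarrow> mink (X v) (n v) = 0"
    and X: "X differentiable (at u)" and n: "(n has_derivative n') (at u)"
  shows "mink (pderiv_at j X u) (n u) = - mink (X u) (n' (axis j 1))"
proof -
  obtain X' where X': "(X has_derivative X') (at u)"
    using X by (auto simp: differentiable_def)
  have "((\<lambda>v. mink (X v) (n v)) has_derivative (\<lambda>h. mink (X u) (n' h) + mink (X' h) (n u))) (at u)"
    by (rule mink.FDERIV[OF X' n])
  then have "((\<lambda>v. 0) has_derivative (\<lambda>h. mink (X u) (n' h) + mink (X' h) (n u))) (at u)"
    by (rule has_derivative_transform_within_open[OF _ U]) (simp add: orth)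
  then have "(\<lambda>h. mink (X u) (n' h) + mink (X' h) (n u)) = (\<lambda>h. 0)"
    by (rule has_derivative_unique) simp
  then have "mink (X u) (n' (axis j 1)) + mink (X' (axis j 1)) (n u) = 0"
    by metis
  then show ?thesis by (simp add: pderiv_at_eq[OF X'])
qed

lemma along_curve:
  assumes "(F has_vector_derivative F') (at ((u::real^3)$1))"
  shows "((\<lambda>v. F (v$1)) has_derivative (\<lambda>h. h$1 *\<^sub>R F')) (at u)"
  using has_derivative_compose[OF bounded_linear.has_derivative[OF bounded_linear_vec_nth has_derivative_ident]
      assms[unfolded has_vector_derivative_def]]
  by simp

lemma along_params:
  assumes "(\<phi> has_derivative \<phi>') (at ((u::real^3)$2, u$3))"
  shows "((\<lambda>v. \<phi> (v$2, v$3)) has_derivative (\<lambda>h. \<phi>' (h$2, h$3))) (at u)"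
  using has_derivative_compose[OF has_derivative_Pair[OF
        bounded_linear.has_derivative[OF bounded_linear_vec_nth has_derivative_ident]
        bounded_linear.has_derivative[OF bounded_linear_vec_nth has_derivative_ident]] assms]
  by simp

text \<open>The derivative \<open>\<phi>'\<close> takes a point and a direction and is differentiated only in the point, with the
  direction held fixed. In this form the closure properties below reduce to the usual product and chain rules.\<close>

definition twice_differentiable_on :: "'a::real_normed_vector set \<Rightarrow> ('a \<Rightarrow> real) \<Rightarrow> ('a \<Rightarrow> 'a \<Rightarrow> real) \<Rightarrow> bool"
  where "twice_differentiable_on D \<phi> \<phi>' \<longleftrightarrow>
    (\<forall>p\<in>D. (\<phi> has_derivative \<phi>' p) (at p)) \<and> (\<forall>p\<in>D. \<forall>v. (\<lambda>q. \<phi>' q v) differentiable (at p))"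

lemma C2_on_imp_twice_differentiable_on:
  assumes "C2_on D \<phi>"
  obtains \<phi>' where "twice_differentiable_on D \<phi> \<phi>'"
proof -
  obtain \<phi>' :: "real \<times> real \<Rightarrow> (real \<times> real) \<Rightarrow>\<^sub>L real"
    and \<phi>'' :: "real \<times> real \<Rightarrow> (real \<times> real) \<Rightarrow>\<^sub>L (real \<times> real) \<Rightarrow>\<^sub>L real"
    where 1: "\<forall>p\<in>D. (\<phi> has_derivative blinfun_apply (\<phi>' p)) (at p)"
      and 2: "\<forall>p\<in>D. (\<phi>' has_derivative blinfun_apply (\<phi>'' p)) (at p)"
    using assms unfolding C2_on_def by blast
  have "(\<lambda>q. blinfun_apply (\<phi>' q) v) differentiable (at p)" if "p \<in> D" for p v
    using blinfun.FDERIV[OF bspec[OF 2 that] has_derivative_const[of v]]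
    by (auto simp: differentiable_def)
  with 1 that[of "\<lambda>p. blinfun_apply (\<phi>' p)"] show thesis
    by (simp add: twice_differentiable_on_def)
qed

lemma twice_differentiable_on_compose:
  assumes \<phi>: "twice_differentiable_on D \<phi> \<phi>'"
    and h: "\<And>p. p \<in> D \<Longrightarrow> (h has_real_derivative h' (\<phi> p)) (at (\<phi> p))"
    and h': "\<And>p. p \<in> D \<Longrightarrow> h' differentiable (at (\<phi> p))"
  shows "twice_differentiable_on D (\<lambda>p. h (\<phi> p)) (\<lambda>p v. h' (\<phi> p) * \<phi>' p v)"
  unfolding twice_differentiable_on_def
proof (intro conjI ballI allI)
  fix p assume p: "p \<in> D"
  then have d: "(\<phi> has_derivative \<phi>' p) (at p)" and d2: "\<And>v. (\<lambda>q. \<phi>' q v) differentiable (at p)"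
    using \<phi> by (auto simp: twice_differentiable_on_def)
  show "((\<lambda>p. h (\<phi> p)) has_derivative (\<lambda>v. h' (\<phi> p) * \<phi>' p v)) (at p)"
    using has_derivative_compose[OF d h[OF p, unfolded has_field_derivative_def]] by simp
  have "(\<lambda>q. h' (\<phi> q)) differentiable (at p)"
    using differentiable_compose[of h' \<phi> p UNIV] h'[OF p] d by (auto simp: differentiable_def)
  then show "(\<lambda>q. h' (\<phi> q) * \<phi>' q v) differentiable (at p)" for v
    using d2 by (intro differentiable_mult)
qed

lemma twice_differentiable_on_mult:
  assumes \<phi>: "twice_differentiable_on D \<phi> \<phi>'" and \<psi>: "twice_differentiable_on D \<psi> \<psi>'"
  shows "twice_differentiable_on D (\<lambda>p. \<phi> p * \<psi> p) (\<lambda>p v. \<phi> p * \<psi>' p v + \<phi>' p v * \<psi> p)"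
  unfolding twice_differentiable_on_def
proof (intro conjI ballI allI)
  fix p assume p: "p \<in> D"
  then have d: "(\<phi> has_derivative \<phi>' p) (at p)" "(\<psi> has_derivative \<psi>' p) (at p)"
    and d2: "\<And>v. (\<lambda>q. \<phi>' q v) differentiable (at p)" "\<And>v. (\<lambda>q. \<psi>' q v) differentiable (at p)"
    using \<phi> \<psi> by (auto simp: twice_differentiable_on_def)
  show "((\<lambda>p. \<phi> p * \<psi> p) has_derivative (\<lambda>v. \<phi> p * \<psi>' p v + \<phi>' p v * \<psi> p)) (at p)"
    by (rule has_derivative_mult[OF d])
  show "(\<lambda>q. \<phi> q * \<psi>' q v + \<phi>' q v * \<psi> q) differentiable (at p)" for v
    using d d2 by (intro differentiable_mult differentiable_add) (auto simp: differentiable_def)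
qed

section \<open>Tubes over partially null curves\<close>

text \<open>The coefficients \<open>A, B, C\<close> of a radial field relative to \<open>F2, F3, F4\<close> are arbitrary functions subject only
  to the equation of a hyperquadric; \<open>e\<close> tells whether the radial field is spacelike or timelike.\<close>

locale partially_null_tube =
  fixes I :: "real set" and \<gamma> F1 F2 F3 F4 :: "real \<Rightarrow> real^4" and k1 k2 k3 :: "real \<Rightarrow> real"
    and D :: "(real \<times> real) set" and A B C :: "real \<times> real \<Rightarrow> real"
    and A' B' C' :: "real \<times> real \<Rightarrow> real \<times> real \<Rightarrow> real"
    and e sg r :: real
  assumes curve: "partially_null_curve I \<gamma> F1 F2 F3 F4 k1 k2 k3"
    and open_D: "open D"
    and dA: "twice_differentiable_on D A A'"
    and dB: "twice_differentiable_on D B B'"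
    and dC: "twice_differentiable_on D C C'"
    and quad: "p \<in> D \<Longrightarrow> (A p)\<^sup>2 + 2 * B p * C p = e"
    and e: "e \<in> {-1, 1}" and sg: "sg \<in> {-1, 1}" and r: "r > 0"
begin

definition radial :: "real^3 \<Rightarrow> real^4" where
  "radial u = A (u$2, u$3) *\<^sub>R F2 (u$1) + B (u$2, u$3) *\<^sub>R F3 (u$1) + C (u$2, u$3) *\<^sub>R F4 (u$1)"

definition dradial :: "real^3 \<Rightarrow> real^3 \<Rightarrow> real^4" where
  "dradial u h =
     (- h$1 * k1 (u$1) * A (u$2, u$3)) *\<^sub>R F1 (u$1)
   + (A' (u$2, u$3) (h$2, h$3) - h$1 * k2 (u$1) * C (u$2, u$3)) *\<^sub>R F2 (u$1)
   + (B' (u$2, u$3) (h$2, h$3) + h$1 * k2 (u$1) * A (u$2, u$3)) *\<^sub>R F3 (u$1)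
   + C' (u$2, u$3) (h$2, h$3) *\<^sub>R F4 (u$1)"

abbreviation \<rho> where "\<rho> \<equiv> sg * r"

abbreviation T :: "real^3 \<Rightarrow> real^4" where "T \<equiv> tube sg r \<gamma> radial"

definition dT :: "real^3 \<Rightarrow> real^3 \<Rightarrow> real^4" where
  "dT u h = h$1 *\<^sub>R F1 (u$1) + \<rho> *\<^sub>R dradial u h"

definition U :: "(real^3) set" where "U = {u. u$1 \<in> I \<and> (u$2, u$3) \<in> D}"

lemma open_U: "open U"
proof -
  have "open ((\<lambda>u::real^3. u$1) -` I)"
    using curve by (intro open_vimage continuous_intros) (simp add: partially_null_curve_def)
  moreover have "open ((\<lambda>u::real^3. (u$2, u$3)) -` D)"
    by (intro open_vimage continuous_intros open_D)
  moreover have "U = (\<lambda>u::real^3. u$1) -` I \<inter> (\<lambda>u::real^3. (u$2, u$3)) -` D"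
    by (auto simp: U_def)
  ultimately show ?thesis by auto
qed

lemma rho_nz: "\<rho> \<noteq> 0" and rho_sq: "\<rho>\<^sup>2 = r\<^sup>2"
  using sg r by auto

lemma frenet:
  assumes "s \<in> I"
  shows "(\<gamma> has_vector_derivative F1 s) (at s)"
    "(F1 has_vector_derivative k1 s *\<^sub>R F2 s) (at s)"
    "(F2 has_vector_derivative - k1 s *\<^sub>R F1 s + k2 s *\<^sub>R F3 s) (at s)"
    "(F3 has_vector_derivative 0) (at s)"
    "(F4 has_vector_derivative - k2 s *\<^sub>R F2 s) (at s)"
    "k1 differentiable (at s)" "k2 differentiable (at s)"
  using curve assms
  by (auto simp: partially_null_curve_def differentiable_on_eq_differentiable_at)

lemma mink_frame:
  assumes "s \<in> I"
  shows "mink (a1 *\<^sub>R F1 s + a2 *\<^sub>R F2 s + a3 *\<^sub>R F3 s + a4 *\<^sub>R F4 s)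
           (b1 *\<^sub>R F1 s + b2 *\<^sub>R F2 s + b3 *\<^sub>R F3 s + b4 *\<^sub>R F4 s)
         = a1 * b1 + a2 * b2 + a3 * b4 + a4 * b3"
  using curve assms
  by (simp add: partially_null_curve_def mink.add_left mink.add_right mink.scaleR_left
      mink.scaleR_right mink_commute algebra_simps)

lemma radial_has_derivative:
  assumes "u \<in> U"
  shows "(radial has_derivative dradial u) (at u)"
proof -
  have s: "u$1 \<in> I" and p: "(u$2, u$3) \<in> D" using assms by (auto simp: U_def)
  note F = along_curve[OF frenet(3)[OF s]] along_curve[OF frenet(4)[OF s]] along_curve[OF frenet(5)[OF s]]
  have P: "((\<lambda>v. A (v$2, v$3)) has_derivative (\<lambda>h. A' (u$2, u$3) (h$2, h$3))) (at u)"
    "((\<lambda>v. B (v$2, v$3)) has_derivative (\<lambda>h. B' (u$2, u$3) (h$2, h$3))) (at u)"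
    "((\<lambda>v. C (v$2, v$3)) has_derivative (\<lambda>h. C' (u$2, u$3) (h$2, h$3))) (at u)"
    using dA dB dC p by (auto intro!: along_params simp: twice_differentiable_on_def)
  show ?thesis
    unfolding radial_def[abs_def]
    by (rule has_derivative_eq_rhs[OF has_derivative_add[OF has_derivative_add[OF
            has_derivative_scaleR[OF P(1) F(1)] has_derivative_scaleR[OF P(2) F(2)]]
            has_derivative_scaleR[OF P(3) F(3)]]])
      (simp add: fun_eq_iff dradial_def algebra_simps)
qed

lemma T_has_derivative:
  assumes "u \<in> U"
  shows "(T has_derivative dT u) (at u)"
proof -
  have s: "u$1 \<in> I" using assms by (auto simp: U_def)
  show ?thesis
    unfolding tube_def[abs_def]
    by (rule has_derivative_eq_rhs[OF has_derivative_add[OF along_curve[OF frenet(1)[OF s]]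
            has_derivative_scaleR_right[OF radial_has_derivative[OF assms]]]])
      (simp add: fun_eq_iff dT_def)
qed

lemma dT_differentiable:
  assumes "u \<in> U"
  shows "(\<lambda>v. dT v h) differentiable (at u)"
proof -
  have s: "u$1 \<in> I" and p: "(u$2, u$3) \<in> D" using assms by (auto simp: U_def)
  have S: "(\<lambda>v. F (v$1)) differentiable (at u)" if "(F has_vector_derivative F') (at (u$1))"
    for F :: "real \<Rightarrow> 'z::real_normed_vector" and F'
    using along_curve[OF that] by (auto simp: differentiable_def)
  have F: "(\<lambda>v. F1 (v$1)) differentiable (at u)" "(\<lambda>v. F2 (v$1)) differentiable (at u)"
    "(\<lambda>v. F3 (v$1)) differentiable (at u)" "(\<lambda>v. F4 (v$1)) differentiable (at u)"
    using frenet(2-5)[OF s] by (auto intro: S)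
  have k: "(\<lambda>v. k1 (v$1)) differentiable (at u)" "(\<lambda>v. k2 (v$1)) differentiable (at u)"
    using frenet(6,7)[OF s] by (auto intro: S simp: vector_derivative_works)
  have P: "(\<lambda>v. \<phi> (v$2, v$3)) differentiable (at u)" if "\<phi> differentiable (at (u$2, u$3))"
    for \<phi> :: "real \<times> real \<Rightarrow> real"
    using that along_params[of \<phi> _ u] by (auto simp: differentiable_def)
  have A: "A differentiable (at (u$2, u$3))" "C differentiable (at (u$2, u$3))"
    and A': "(\<lambda>q. A' q v) differentiable (at (u$2, u$3))"
    "(\<lambda>q. B' q v) differentiable (at (u$2, u$3))"
    "(\<lambda>q. C' q v) differentiable (at (u$2, u$3))" for v
    using dA dB dC p unfolding twice_differentiable_on_def differentiable_def by blast+
  note [intro!] = F k P[OF A(1)] P[OF A(2)] P[OF A'(1)] P[OF A'(2)] P[OF A'(3)]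
    differentiable_add differentiable_diff differentiable_scaleR differentiable_mult differentiable_const
  show ?thesis
    unfolding dT_def dradial_def by auto
qed

lemma pderiv_T: "u \<in> U \<Longrightarrow> pderiv_at i T u = dT u (axis i 1)"
  by (rule pderiv_at_eq[OF T_has_derivative])

lemma mink_radial_radial: "u \<in> U \<Longrightarrow> mink (radial u) (radial u) = e"
  using quad[of "(u$2, u$3)"]
    mink_frame[of "u$1" 0 "A (u$2,u$3)" "B (u$2,u$3)" "C (u$2,u$3)" 0 "A (u$2,u$3)" "B (u$2,u$3)" "C (u$2,u$3)"]
  by (simp add: radial_def U_def power2_eq_square)

text \<open>The differentiated hyperquadric equation. In frame coordinates it says that the derivatives of the radial
  field in the parameters \<open>t, w\<close> are orthogonal to it.\<close>

lemma quad_deriv: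
  assumes "p \<in> D"
  shows "A p * A' p v + B p * C' p v + C p * B' p v = 0"
proof -
  have d: "(A has_derivative A' p) (at p)" "(B has_derivative B' p) (at p)" "(C has_derivative C' p) (at p)"
    using dA dB dC assms by (auto simp: twice_differentiable_on_def)
  have "((\<lambda>q. A q * A q + 2 * (B q * C q)) has_derivative
      (\<lambda>v. (A p * A' p v + A' p v * A p) + 2 * (B p * C' p v + B' p v * C p))) (at p)"
    using d by (intro has_derivative_add has_derivative_mult has_derivative_mult_right)
  then have "((\<lambda>q. e) has_derivative
      (\<lambda>v. (A p * A' p v + A' p v * A p) + 2 * (B p * C' p v + B' p v * C p))) (at p)"
    by (rule has_derivative_transform_within_open[OF _ open_D assms])
      (use quad in \<open>simp add: power2_eq_square mult.assoc\<close>)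
  then have "(\<lambda>v. (A p * A' p v + A' p v * A p) + 2 * (B p * C' p v + B' p v * C p)) = (\<lambda>v. 0)"
    by (rule has_derivative_unique) simp
  then have "(A p * A' p v + A' p v * A p) + 2 * (B p * C' p v + B' p v * C p) = 0"
    by metis
  then show ?thesis by (simp add: algebra_simps)
qed

text \<open>The derivative of the tube in frame coordinates. Along the curve the only change in the \<open>F1\<close> direction
  is the factor \<open>1 - \<rho> k1 A\<close>; the rest is \<open>\<rho> k2\<close> times \<open>A F3 - C F2\<close>,
  which is orthogonal to both \<open>F1\<close> and the radial field.\<close>

lemma dT_frame:
  "dT u h = (h$1 * (1 - \<rho> * k1 (u$1) * A (u$2, u$3))) *\<^sub>R F1 (u$1)
     + (\<rho> * (A' (u$2, u$3) (h$2, h$3) - h$1 * k2 (u$1) * C (u$2, u$3))) *\<^sub>R F2 (u$1)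
     + (\<rho> * (B' (u$2, u$3) (h$2, h$3) + h$1 * k2 (u$1) * A (u$2, u$3))) *\<^sub>R F3 (u$1)
     + (\<rho> * C' (u$2, u$3) (h$2, h$3)) *\<^sub>R F4 (u$1)"
  by (simp add: dT_def dradial_def algebra_simps)

lemma mink_dT_radial:
  assumes "u \<in> U"
  shows "mink (dT u h) (radial u) = 0"
proof -
  have s: "u$1 \<in> I" and p: "(u$2, u$3) \<in> D" using assms by (auto simp: U_def)
  have n: "radial u = 0 *\<^sub>R F1 (u$1) + A (u$2, u$3) *\<^sub>R F2 (u$1) + B (u$2, u$3) *\<^sub>R F3 (u$1) + C (u$2, u$3) *\<^sub>R F4 (u$1)"
    by (simp add: radial_def)
  show ?thesis
    unfolding dT_frame n mink_frame[OF s]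
    using quad_deriv[OF p, of "(h$2, h$3)"] by algebra
qed

lemma mink_dT_F1:
  assumes "u \<in> U"
  shows "mink (dT u h) (F1 (u$1)) = h$1 * (1 - \<rho> * k1 (u$1) * A (u$2, u$3))"
  using assms mink_frame[of "u$1" _ _ _ _ 1 0 0 0] by (simp add: dT_frame U_def)

text \<open>The second fundamental form with respect to the radial field. Because the tube is \<open>\<gamma> + \<rho> radial\<close>,
  the derivative of \<open>radial\<close> is \<open>1 / \<rho>\<close> times that of the tube, except for the contribution
  \<open>F1\<close> of \<open>\<gamma>\<close>, which affects only the entry at \<open>(1,1)\<close>.\<close>

lemma mink_pderiv2_radial:
  assumes u: "u \<in> U"
  shows "mink (pderiv_at j (pderiv_at i T) u) (radial u) =
    - (1 / \<rho>) * (mink (pderiv_at i T u) (pderiv_at j T u)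
       - (if i = 1 \<and> j = 1 then 1 - \<rho> * k1 (u$1) * A (u$2, u$3) else 0))"
proof -
  have d: "pderiv_at i T differentiable (at u)"
  proof -
    obtain L where "((\<lambda>v. dT v (axis i 1)) has_derivative L) (at u)"
      using dT_differentiable[OF u] by (auto simp: differentiable_def)
    then have "(pderiv_at i T has_derivative L) (at u)"
      by (rule has_derivative_transform_within_open[OF _ open_U u]) (simp add: pderiv_T)
    then show ?thesis by (auto simp: differentiable_def)
  qed
  have "mink (pderiv_at j (pderiv_at i T) u) (radial u) = - mink (pderiv_at i T u) (dradial u (axis j 1))"
    by (rule mink_pderiv_orthogonal[OF open_U u _ d radial_has_derivative[OF u]])
      (simp add: pderiv_T mink_dT_radial)
  also have "dradial u (axis j 1) = (1 / \<rho>) *\<^sub>R (dT u (axis j 1) - (axis j 1 :: real^3)$1 *\<^sub>R F1 (u$1))"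
    using rho_nz by (simp add: dT_def)
  finally show ?thesis
    unfolding pderiv_T[OF u] mink.scaleR_right mink.diff_right mink_dT_F1[OF u]
    by (simp add: axis_def)
qed

text \<open>The vectors \<open>A F3 - C F2\<close> and the two partial derivatives of the radial field in the parameters \<open>t, w\<close>
  lie in the span of \<open>F2, F3, F4\<close> and are orthogonal to the radial field, hence lie in a plane. So
  \<open>T\<^sub>s\<close> is \<open>1 - \<rho> k1 A\<close> times the unit vector \<open>F1\<close>, which is orthogonal to that plane, up
  to a vector of the plane, and the Gram determinant is the one of the plane times the square of this height.\<close>

lemma det_first_form:
  assumes u: "u \<in> U"
  shows "det (first_form T u) = (1 - \<rho> * k1 (u$1) * A (u$2, u$3))\<^sup>2
     * (first_form T u $2$2 * first_form T u $3$3 - first_form T u $2$3 * first_form T u $3$2)"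
proof -
  have s: "u$1 \<in> I" and p: "(u$2, u$3) \<in> D" using u by (auto simp: U_def)
  define a where "a = 1 - \<rho> * k1 (u$1) * A (u$2, u$3)"
  define k where "k = k2 (u$1)"
  define \<alpha> \<beta> \<zeta> where "\<alpha> = A (u$2, u$3)" "\<beta> = B (u$2, u$3)" "\<zeta> = C (u$2, u$3)"
  define a1 b1 c1 where "a1 = A' (u$2, u$3) (1, 0)" "b1 = B' (u$2, u$3) (1, 0)" "c1 = C' (u$2, u$3) (1, 0)"
  define a2 b2 c2 where "a2 = A' (u$2, u$3) (0, 1)" "b2 = B' (u$2, u$3) (0, 1)" "c2 = C' (u$2, u$3) (0, 1)"
  have z: "A' (u$2, u$3) (0, 0) = 0" "B' (u$2, u$3) (0, 0) = 0" "C' (u$2, u$3) (0, 0) = 0"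
    using dA dB dC p unfolding twice_differentiable_on_def zero_prod_def[symmetric]
    by (metis has_derivative_linear linear_0)+
  have q: "\<alpha> * a1 + \<beta> * c1 + \<zeta> * b1 = 0" "\<alpha> * a2 + \<beta> * c2 + \<zeta> * b2 = 0"
    and qe: "\<alpha>\<^sup>2 + 2 * \<beta> * \<zeta> = e"
    using quad_deriv[OF p] quad[OF p]
    by (simp_all add: \<alpha>_\<beta>_\<zeta>_def a1_b1_c1_def a2_b2_c2_def)
  \<comment> \<open>The frame coordinates \<open>(-\<zeta>, \<alpha>, 0)\<close>, \<open>(a1, b1, c1)\<close>, \<open>(a2, b2, c2)\<close> of the three vectors are annihilated by the covector \<open>(\<alpha>, \<zeta>, \<beta>)\<close>, so their determinant \<open>\<Delta>\<close> vanishes.\<close>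
  define \<Delta> where "\<Delta> = - \<zeta> * (b1 * c2 - c1 * b2) - \<alpha> * (a1 * c2 - c1 * a2)"
  have "e * \<Delta> = 0" unfolding \<Delta>_def qe[symmetric] using q by algebra
  then have \<Delta>: "\<Delta> = 0" using e by auto
  have g: "first_form T u $1$1 = a * a + \<rho>\<^sup>2 * k\<^sup>2 * \<zeta>\<^sup>2"
    "first_form T u $1$2 = \<rho>\<^sup>2 * k * (\<alpha> * c1 - \<zeta> * a1)"
    "first_form T u $2$1 = \<rho>\<^sup>2 * k * (\<alpha> * c1 - \<zeta> * a1)"
    "first_form T u $1$3 = \<rho>\<^sup>2 * k * (\<alpha> * c2 - \<zeta> * a2)"
    "first_form T u $3$1 = \<rho>\<^sup>2 * k * (\<alpha> * c2 - \<zeta> * a2)"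
    "first_form T u $2$2 = \<rho>\<^sup>2 * (a1 * a1 + 2 * b1 * c1)"
    "first_form T u $2$3 = \<rho>\<^sup>2 * (a1 * a2 + b1 * c2 + c1 * b2)"
    "first_form T u $3$2 = \<rho>\<^sup>2 * (a1 * a2 + b1 * c2 + c1 * b2)"
    "first_form T u $3$3 = \<rho>\<^sup>2 * (a2 * a2 + 2 * b2 * c2)"
    unfolding first_form_def vec_lambda_beta pderiv_T[OF u] dT_frame mink_frame[OF s]
      a_def[symmetric]
    by (simp_all add: axis_def z k_def[symmetric] \<alpha>_\<beta>_\<zeta>_def[symmetric]
        a1_b1_c1_def[symmetric] a2_b2_c2_def[symmetric] power2_eq_square algebra_simps)
  have "det (first_form T u) = a\<^sup>2 * (first_form T u $2$2 * first_form T u $3$3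
      - first_form T u $2$3 * first_form T u $3$2) - \<rho>^6 * k\<^sup>2 * \<Delta>\<^sup>2"
    unfolding det_3 g \<Delta>_def by algebra
  then show ?thesis by (simp add: \<Delta> a_def)
qed

text \<open>The second fundamental form is \<open>- c / \<rho>\<close> times the first one corrected at the entry \<open>(1,1)\<close>.
  So the shape operator has the principal curvatures \<open>- c / \<rho>\<close>, twice, and \<open>c k1 A / (1 - x)\<close>.
  That \<open>x \<noteq> 1\<close> is forced by regularity, since \<open>1 - x\<close> is the height that enters the Gram determinant.\<close>

lemma curvatures:
  assumes u: "u \<in> U" and reg: "regular_point T u"
  defines "x \<equiv> \<rho> * k1 (u$1) * A (u$2, u$3)"
  obtains c where "c \<in> {-1, 1}" "unit_normal T u = c *\<^sub>R radial u" "x \<noteq> 1"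
    "gaussian_curvature T u = c * e * (k1 (u$1) * A (u$2, u$3) / (r\<^sup>2 * (1 - x)))"
    "mean_curvature T u = c * e * ((-2 + 3 * x) / (3 * \<rho> * (1 - x)))"
proof -
  define N where "N = normal_vec T u"
  define m where "m = mink (radial u) N / e"
  define c where "c = sgn m"
  define G where "G = first_form T u"
  define cof where "cof = G$2$2 * G$3$3 - G$2$3 * G$3$2"
  have ee: "e * e = 1" and e0: "e \<noteq> 0" using e by auto
  have orth: "mink (radial u) (pderiv_at i T u) = 0" for i
    by (metis mink_commute mink_dT_radial pderiv_T u)
  have "e *\<^sub>R N = mink (radial u) N *\<^sub>R radial u"
    using vprod_parallel[OF orth orth orth] by (simp add: N_def normal_vec_def mink_radial_radial[OF u])
  then have "(1 / e) *\<^sub>R (e *\<^sub>R N) = (1 / e) *\<^sub>R (mink (radial u) N *\<^sub>R radial u)" by simp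
  then have N: "N = m *\<^sub>R radial u" using e0 by (simp add: m_def)
  then have NN: "mink N N = m\<^sup>2 * e"
    by (simp add: mink.scaleR_left mink.scaleR_right mink_radial_radial[OF u] power2_eq_square)
  have norm: "mnorm N = \<bar>m\<bar>" unfolding mnorm_def NN using e by (auto simp: abs_mult)
  then have m: "m \<noteq> 0" using reg by (simp add: regular_point_def N_def)
  have c: "c \<in> {-1, 1}" using m by (auto simp: c_def sgn_if)
  have un: "unit_normal T u = c *\<^sub>R radial u"
    unfolding unit_normal_def N_def[symmetric] norm
    unfolding N using m by (auto simp: c_def sgn_if)
  have sign: "normal_sign T u = e"
    using c by (auto simp: normal_sign_def un mink.scaleR_left mink.scaleR_right mink_radial_radial[OF u])
  have "det G = - mink N N"
    unfolding G_def first_form_def N_def normal_vec_def by (rule gram_det_eq_vprod)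
  then have detG: "det G \<noteq> 0" using NN m e0 by simp
  have cof: "det G = (1 - x)\<^sup>2 * cof"
    using det_first_form[OF u] by (simp add: G_def cof_def x_def)
  with detG have x: "x \<noteq> 1" and cof0: "cof \<noteq> 0" by auto
  have h: "second_form T u = (\<chi> i j. - (c / \<rho>) * (G$i$j - (if i = 1 \<and> j = 1 then 1 - x else 0)))"
    unfolding second_form_def un mink.scaleR_right mink_pderiv2_radial[OF u] G_def first_form_def x_def
    by (simp add: vec_eq_iff)
  define \<mu> where "\<mu> = - (c / \<rho>)"
  have "det (second_form T u) = \<mu>^3 * (det G - (1 - x) * cof)"
    unfolding h \<mu>_def[symmetric] det_3 cof_def by (simp add: power3_eq_cube algebra_simps)
  also have "det G - (1 - x) * cof = - x * (1 - x) * cof"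
    unfolding cof by (simp add: power2_eq_square algebra_simps)
  also have "\<mu>^3 = - c / (\<rho> * r\<^sup>2)"
    using c rho_sq by (auto simp: \<mu>_def power3_eq_cube power2_eq_square)
  finally have "det (second_form T u) / det G = c * x / (\<rho> * r\<^sup>2 * (1 - x))"
    using x cof0 by (simp add: cof power2_eq_square)
  moreover have "gaussian_curvature T u = e * (det (second_form T u) / det G)"
    by (simp add: gaussian_curvature_def sign G_def)
  ultimately have K: "gaussian_curvature T u = c * e * (k1 (u$1) * A (u$2, u$3) / (r\<^sup>2 * (1 - x)))"
    using rho_nz by (simp add: x_def)
  have "trace (shape_operator T u) = - (c / \<rho>) * (3 - (1 - x) * cof / det G)"
    unfolding shape_operator_def G_def[symmetric] cof_def
    by (rule trace_matrix_inv_rank_one[OF detG h])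
  also have "3 - (1 - x) * cof / det G = (2 - 3 * x) / (1 - x)"
  proof -
    have "(1 - x) * cof / det G = 1 / (1 - x)"
      using x cof0 by (simp add: cof power2_eq_square)
    then show ?thesis using x by (simp add: field_simps)
  qed
  also have "- (c / \<rho>) * ((2 - 3 * x) / (1 - x)) = c * ((-2 + 3 * x) / (\<rho> * (1 - x)))"
  proof -
    have "- (c / \<rho>) * ((2 - 3 * x) / (1 - x)) = (- c * (2 - 3 * x)) / (\<rho> * (1 - x))"
      by simp
    also have "- c * (2 - 3 * x) = c * (-2 + 3 * x)"
      by (simp add: algebra_simps)
    finally show ?thesis by simp
  qed
  finally have "mean_curvature T u = c * e * ((-2 + 3 * x) / (3 * \<rho> * (1 - x)))"
    using e by (auto simp: mean_curvature_def sign)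
  with c un x K show thesis by (rule that)
qed

end

section \<open>The four families\<close>

text \<open>All four families have the coefficients \<open>a(f)\<close>, \<open>g b(f)\<close> and \<open>\<epsilon> b(f) / (2 g)\<close> with
  \<open>a\<^sup>2 + \<epsilon> b\<^sup>2 = e\<close> constant. In the square of the radial field \<open>g\<close> cancels, and only the
  coefficient \<open>a(f)\<close> of \<open>F2\<close> enters the curvatures. The sign \<open>\<sigma>\<close> selects the field
  \<open>n\<close> or \<open>- n\<close> from which the sign \<open>\<eta>\<close> of the unit normal is counted.\<close>

lemma tube_curvatures:
  fixes a b a' b' :: "real \<Rightarrow> real" and n :: "real^3 \<Rightarrow> real^4"
  assumes curve: "partially_null_curve I \<gamma> F1 F2 F3 F4 k1 k2 k3"
    and r: "r > 0" and sg: "sg \<in> {- 1, 1}"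
    and D: "open D" and f: "C2_on D f" and g: "C2_on D g" and g0: "\<forall>p\<in>D. g p \<noteq> 0"
    and s: "s \<in> I" and tw: "(t, w) \<in> D"
    and a: "\<And>x. (a has_real_derivative a' x) (at x)" "\<And>x. a' differentiable (at x)"
    and b: "\<And>x. (b has_real_derivative b' x) (at x)" "\<And>x. b' differentiable (at x)"
    and ab: "\<And>x. (a x)\<^sup>2 + \<epsilon> * (b x)\<^sup>2 = e" and e: "e \<in> {-1, 1}" and \<sigma>: "\<sigma> \<in> {-1, 1}"
    and n: "\<And>u. n u = a (f (u$2, u$3)) *\<^sub>R F2 (u$1) + (g (u$2, u$3) * b (f (u$2, u$3))) *\<^sub>R F3 (u$1)
              + (\<epsilon> * b (f (u$2, u$3)) / (2 * g (u$2, u$3))) *\<^sub>R F4 (u$1)"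
    and reg: "regular_point (tube sg r \<gamma> n) (vector [s, t, w])"
  defines "T \<equiv> tube sg r \<gamma> n" and "u \<equiv> vector [s, t, w]" and "\<kappa> \<equiv> k1 s" and "\<alpha> \<equiv> a (f (t, w))"
  shows "\<exists>\<eta>\<in>{- 1, 1}. unit_normal T u = \<eta> *\<^sub>R (\<sigma> *\<^sub>R n u) \<and>
      (\<alpha> \<noteq> 0 \<longrightarrow>
         gaussian_curvature T u = \<eta> * (\<sigma> * e * \<kappa> / (r\<^sup>2 * (1 / \<alpha> - sg * r * \<kappa>)))) \<and>
      (- 2 + 3 * (sg * r) * \<kappa> * \<alpha> \<noteq> 0 \<longrightarrow>
         mean_curvature T u =
           \<eta> * (\<sigma> * e / (- (sg * r) + sg * r / (- 2 + 3 * (sg * r) * \<kappa> * \<alpha>))))"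
proof -
  obtain f' where f': "twice_differentiable_on D f f'"
    using C2_on_imp_twice_differentiable_on[OF f] .
  obtain g' where g': "twice_differentiable_on D g g'"
    using C2_on_imp_twice_differentiable_on[OF g] .
  have "((\<lambda>x. \<epsilon> / (2 * x)) has_real_derivative - \<epsilon> / (2 * x\<^sup>2)) (at x)"
    and "(\<lambda>x. - \<epsilon> / (2 * x\<^sup>2)) differentiable (at x)" if "x \<noteq> 0" for x :: real
    using that by (auto intro!: derivative_eq_intros derivative_intros simp: field_simps power2_eq_square)
  then have ginv: "twice_differentiable_on D (\<lambda>p. \<epsilon> / (2 * g p)) (\<lambda>p v. - \<epsilon> / (2 * (g p)\<^sup>2) * g' p v)"
    using g0 by (intro twice_differentiable_on_compose[OF g']) auto
  note da = twice_differentiable_on_compose[OF f', of a a', OF a]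
  note db = twice_differentiable_on_compose[OF f', of b b', OF b]
  interpret partially_null_tube I \<gamma> F1 F2 F3 F4 k1 k2 k3 D "\<lambda>p. a (f p)" "\<lambda>p. g p * b (f p)"
    "\<lambda>p. b (f p) * (\<epsilon> / (2 * g p))"
    "\<lambda>p v. a' (f p) * f' p v"
    "\<lambda>p v. g p * (b' (f p) * f' p v) + g' p v * b (f p)"
    "\<lambda>p v. b (f p) * (- \<epsilon> / (2 * (g p)\<^sup>2) * g' p v) + b' (f p) * f' p v * (\<epsilon> / (2 * g p))"
    e sg r
  proof (unfold_locales, fact curve, fact D, fact da, rule twice_differentiable_on_mult[OF g' db],
      rule twice_differentiable_on_mult[OF db ginv])
    fix p assume "p \<in> D"
    then show "(a (f p))\<^sup>2 + 2 * (g p * b (f p)) * (b (f p) * (\<epsilon> / (2 * g p))) = e"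
      using g0 ab[of "f p"] by (simp add: power2_eq_square mult.commute)
  qed (use e sg r in auto)
  have n_eq: "radial = n"
    by (rule ext, unfold radial_def n) (simp add: mult.commute)
  have u: "u \<in> U" using s tw by (simp add: U_def u_def)
  have coords: "u$1 = s" "u$2 = t" "u$3 = w" by (simp_all add: u_def)
  obtain c where c: "c \<in> {-1, 1}" "unit_normal T u = c *\<^sub>R n u" "\<rho> * \<kappa> * \<alpha> \<noteq> 1"
    and K: "gaussian_curvature T u = c * e * (\<kappa> * \<alpha> / (r\<^sup>2 * (1 - \<rho> * \<kappa> * \<alpha>)))"
    and H: "mean_curvature T u = c * e * ((-2 + 3 * (\<rho> * \<kappa> * \<alpha>)) / (3 * \<rho> * (1 - \<rho> * \<kappa> * \<alpha>)))"
    using curvatures[OF u] reg unfolding n_eq coords \<alpha>_def \<kappa>_def T_def u_def[symmetric] by metis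
  have \<sigma>\<sigma>: "\<sigma> * \<sigma> = 1" using \<sigma> by auto
  show ?thesis
  proof (intro bexI[of _ "c * \<sigma>"] conjI impI)
    show "c * \<sigma> \<in> {- 1, 1}" using c(1) \<sigma> by auto
    show "unit_normal T u = (c * \<sigma>) *\<^sub>R (\<sigma> *\<^sub>R n u)"
      using c(2) by (simp add: mult.assoc \<sigma>\<sigma>)
    have ce: "c * e * z = c * \<sigma> * (\<sigma> * e * z)" for z
      using \<sigma> by auto
    {
      assume "\<alpha> \<noteq> 0"
      then have "1 / \<alpha> - \<rho> * \<kappa> = (1 - \<rho> * \<kappa> * \<alpha>) / \<alpha>" by (simp add: field_simps)
      then have "gaussian_curvature T u = c * e * (\<kappa> / (r\<^sup>2 * (1 / \<alpha> - \<rho> * \<kappa>)))"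
        using K by simp
      then show "gaussian_curvature T u = c * \<sigma> * (\<sigma> * e * \<kappa> / (r\<^sup>2 * (1 / \<alpha> - \<rho> * \<kappa>)))"
        by (simp only: ce times_divide_eq_right)
    next
      define y where "y = - 2 + 3 * \<rho> * \<kappa> * \<alpha>"
      assume "- 2 + 3 * \<rho> * \<kappa> * \<alpha> \<noteq> 0"
      then have "y \<noteq> 0" unfolding y_def .
      then have "- \<rho> + \<rho> / y = \<rho> * (1 - y) / y" by (simp add: field_simps)
      also have "1 - y = 3 * (1 - \<rho> * \<kappa> * \<alpha>)" by (simp add: y_def)
      finally have "1 / (- \<rho> + \<rho> / y) = y / (3 * \<rho> * (1 - \<rho> * \<kappa> * \<alpha>))"
        by (simp add: mult.assoc mult.left_commute)
      then have "mean_curvature T u = c * e * (1 / (- \<rho> + \<rho> / y))"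
        using H by (simp add: y_def mult.assoc)
      then have "mean_curvature T u = c * \<sigma> * (\<sigma> * e * (1 / (- \<rho> + \<rho> / y)))"
        by (simp only: ce)
      then show "mean_curvature T u = c * \<sigma> * (\<sigma> * e / (- \<rho> + \<rho> / (- 2 + 3 * \<rho> * \<kappa> * \<alpha>)))"
        by (simp only: times_divide_eq_right mult_1_right y_def)
    }
  qed
qed

theorem theorem10:
  fixes \<gamma> F1 F2 F3 F4 :: "real \<Rightarrow> real^4"
    and k1 k2 k3 :: "real \<Rightarrow> real"
    and f g :: "real \<times> real \<Rightarrow> real"
    and I :: "real set" and D :: "(real \<times> real) set"
    and r sg s t w :: real
  defines "n1 \<equiv> radial1 F2 F3 F4 f g" and "n2 \<equiv> radial2 F2 F3 F4 f g"
    and "n3 \<equiv> radial3 F2 F3 F4 f g" and "n4 \<equiv> radial4 F2 F3 F4 f g"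
  defines "T1 \<equiv> tube sg r \<gamma> n1" and "T2 \<equiv> tube sg r \<gamma> n2"
    and "T3 \<equiv> tube sg r \<gamma> n3" and "T4 \<equiv> tube sg r \<gamma> n4"
  defines "u \<equiv> vector [s, t, w] :: real^3" and "\<phi> \<equiv> f (t, w)" and "\<kappa> \<equiv> k1 s"
  assumes "partially_null_curve I \<gamma> F1 F2 F3 F4 k1 k2 k3"
    and "r > 0" and "sg \<in> {- 1, 1}"
    and "open D" and "C2_on D f" and "C2_on D g" and "\<forall>p\<in>D. g p \<noteq> 0"
    and "s \<in> I" and "(t, w) \<in> D"
  shows
    "(regular_point T1 u \<longrightarrow> (\<exists>\<eta>\<in>{- 1, 1}. unit_normal T1 u = \<eta> *\<^sub>R n1 u \<and>
        (sin \<phi> \<noteq> 0 \<longrightarrow>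
           gaussian_curvature T1 u = \<eta> * (\<kappa> / (r\<^sup>2 * (csc \<phi> - sg * r * \<kappa>)))) \<and>
        (- 2 + 3 * (sg * r) * \<kappa> * sin \<phi> \<noteq> 0 \<longrightarrow>
           mean_curvature T1 u =
             \<eta> * (1 / (- (sg * r) + sg * r / (- 2 + 3 * (sg * r) * \<kappa> * sin \<phi>)))))) \<and>
     (regular_point T2 u \<longrightarrow> (\<exists>\<eta>\<in>{- 1, 1}. unit_normal T2 u = \<eta> *\<^sub>R (- n2 u) \<and>
        (cos \<phi> \<noteq> 0 \<longrightarrow>
           gaussian_curvature T2 u = \<eta> * (- \<kappa> / (r\<^sup>2 * (sec \<phi> - sg * r * \<kappa>)))) \<and>
        (- 2 + 3 * (sg * r) * \<kappa> * cos \<phi> \<noteq> 0 \<longrightarrow>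
           mean_curvature T2 u =
             \<eta> * (- 1 / (- (sg * r) + sg * r / (- 2 + 3 * (sg * r) * \<kappa> * cos \<phi>)))))) \<and>
     (regular_point T3 u \<longrightarrow> (\<exists>\<eta>\<in>{- 1, 1}. unit_normal T3 u = \<eta> *\<^sub>R n3 u \<and>
        gaussian_curvature T3 u = \<eta> * (\<kappa> / (r\<^sup>2 * (sech \<phi> - sg * r * \<kappa>))) \<and>
        (- 2 + 3 * (sg * r) * \<kappa> * cosh \<phi> \<noteq> 0 \<longrightarrow>
           mean_curvature T3 u =
             \<eta> * (1 / (- (sg * r) + sg * r / (- 2 + 3 * (sg * r) * \<kappa> * cosh \<phi>)))))) \<and>
     (regular_point T4 u \<longrightarrow> (\<exists>\<eta>\<in>{- 1, 1}. unit_normal T4 u = \<eta> *\<^sub>R n4 u \<and>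
        (sinh \<phi> \<noteq> 0 \<longrightarrow>
           gaussian_curvature T4 u = \<eta> * (- \<kappa> / (r\<^sup>2 * (csch \<phi> - sg * r * \<kappa>)))) \<and>
        (- 2 + 3 * (sg * r) * \<kappa> * sinh \<phi> \<noteq> 0 \<longrightarrow>
           mean_curvature T4 u =
             \<eta> * (- 1 / (- (sg * r) + sg * r / (- 2 + 3 * (sg * r) * \<kappa> * sinh \<phi>))))))"
proof -
  \<comment> \<open>Here \<open>\<delta>\<close> is \<open>\<sigma>\<close> times the square of \<open>n\<close>, the sign in the numerators of the stated formulas.\<close>
  define claim where "claim n \<sigma> \<delta> \<alpha> \<longleftrightarrow> (regular_point (tube sg r \<gamma> n) u \<longrightarrow>
    (\<exists>\<eta>\<in>{- 1, 1}. unit_normal (tube sg r \<gamma> n) u = \<eta> *\<^sub>R (\<sigma> *\<^sub>R n u) \<and>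
      (\<alpha> \<noteq> 0 \<longrightarrow> gaussian_curvature (tube sg r \<gamma> n) u
         = \<eta> * (\<delta> * \<kappa> / (r\<^sup>2 * (1 / \<alpha> - sg * r * \<kappa>)))) \<and>
      (- 2 + 3 * (sg * r) * \<kappa> * \<alpha> \<noteq> 0 \<longrightarrow> mean_curvature (tube sg r \<gamma> n) u
         = \<eta> * (\<delta> / (- (sg * r) + sg * r / (- 2 + 3 * (sg * r) * \<kappa> * \<alpha>))))))" for n \<sigma> \<delta> \<alpha>
  have hyp: "(cosh x)\<^sup>2 - (sinh x)\<^sup>2 = 1" "(sinh x)\<^sup>2 - (cosh x)\<^sup>2 = - 1" for x :: real
    using hyperbolic_pythagoras[of x] by simp_all
  have deriv2: "(\<lambda>x. - sin x) differentiable (at x)" "cos differentiable (at x)"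
    "sin differentiable (at x)" "cosh differentiable (at x)" "sinh differentiable (at x)" for x :: real
    unfolding real_differentiable_def by (rule exI, auto intro!: derivative_eq_intros)+
  have C: "claim n \<sigma> \<delta> (a \<phi>)"
    if "\<delta> = \<sigma> * e" "\<And>x. (a has_real_derivative a' x) (at x)" "\<And>x. a' differentiable (at x)"
      "\<And>x. (b has_real_derivative b' x) (at x)" "\<And>x. b' differentiable (at x)"
      "\<And>x. (a x)\<^sup>2 + \<epsilon> * (b x)\<^sup>2 = e" "e \<in> {-1, 1}" "\<sigma> \<in> {-1, 1}"
      "\<And>u. n u = a (f (u$2, u$3)) *\<^sub>R F2 (u$1) + (g (u$2, u$3) * b (f (u$2, u$3))) *\<^sub>R F3 (u$1)
              + (\<epsilon> * b (f (u$2, u$3)) / (2 * g (u$2, u$3))) *\<^sub>R F4 (u$1)" for n a a' b b' e \<epsilon> \<sigma> \<delta>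
    unfolding claim_def u_def \<phi>_def \<kappa>_def that(1)
    by (rule impI, rule tube_curvatures[OF assms(12-20) that(2-)])
  have C1: "claim n1 1 1 (sin \<phi>)"
    by (rule C[where a' = cos and b = cos and b' = "\<lambda>x. - sin x" and \<epsilon> = 1 and e = 1])
      (auto intro!: derivative_eq_intros deriv2 simp: hyp n1_def radial1_def Let_def)
  have C2: "claim n2 (- 1) (- 1) (cos \<phi>)"
    by (rule C[where a' = "\<lambda>x. - sin x" and b = sin and b' = cos and \<epsilon> = 1 and e = 1])
      (auto intro!: derivative_eq_intros deriv2 simp: hyp n2_def radial2_def Let_def)
  have C3: "claim n3 1 1 (cosh \<phi>)"
    by (rule C[where a' = sinh and b = sinh and b' = cosh and \<epsilon> = "- 1" and e = 1])
      (auto intro!: derivative_eq_intros deriv2 simp: hyp n3_def radial3_def Let_def)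
  have C4: "claim n4 1 (- 1) (sinh \<phi>)"
    by (rule C[where a' = cosh and b = cosh and b' = sinh and \<epsilon> = "- 1" and e = "- 1"])
      (auto intro!: derivative_eq_intros deriv2 simp: hyp n4_def radial4_def Let_def)
  note shape = claim_def scaleR_one scaleR_minus1_left mult_1 mult_minus1
  have "cosh \<phi> \<noteq> 0" by simp
  then show ?thesis
    using C1[unfolded shape] C2[unfolded shape] C3[unfolded shape] C4[unfolded shape]
    unfolding T1_def T2_def T3_def T4_def csc_def sec_def sech_def csch_def
    by (simp only: not_False_eq_True simp_thms)
qed

end
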